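(* Every pointed Gumm category is centralic.
   Context: A finitely complete category $\mathbb{C}$ is a Gumm category if for any object $X$ and any three (internal) equivalence relations $R,S,T$ on $X$ with $R\cap S\leqslant T$, the following holds for all generalised elements $x,y,z,w$ of $X$ (i.e. morphisms into $X$ with a common domain): if $(x,y),(w,z)\in R$, $(y,z),(x,w)\in S$ and $(y,z)\in T$, then $(x,w)\in T$. A pointed category is a category with a zero object $0$; zero morphisms are also denoted $0$. For morphisms $x\colon S\to X$, $y\colon S\to Y$, $f\colon X\times Y\to Z$, write $f(x,y)$ for the composite $f\circ(x,y)\colon S\to Z$. A pointed category with finite products is called centralic if for every morphism $f\colon X\times Y\to Z$, every object $S$ and all morphisms $x,x'\colon S\to X$, $y\colon S\to Y$: $f(x,0)=f(x',0)$ implies $f(x,y)=f(x',y)$. *)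

theory Defs
  imports Main
begin

section \<open>Categories and finite limits\<close>

record ('o, 'a) precategory =
  Obj :: "'o set"
  Arr :: "'a set"
  Dom :: "'a \<Rightarrow> 'o"
  Cod :: "'a \<Rightarrow> 'o"
  Id :: "'o \<Rightarrow> 'a"
  Comp :: "'a \<Rightarrow> 'a \<Rightarrow> 'a"  (infixl \<open>\<cdot>\<index>\<close> 70)

definition hom :: "('o, 'a, 'm) precategory_scheme \<Rightarrow> 'o \<Rightarrow> 'o \<Rightarrow> 'a set" where
  "hom C A B = {f \<in> Arr C. Dom C f = A \<and> Cod C f = B}"

text \<open>
  Composition is written in the usual order: \<open>g \<cdot> f\<close> is "first \<open>f\<close>, then \<open>g\<close>". Its value
  is unconstrained when \<open>Cod f \<noteq> Dom g\<close>.
\<close>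

locale category =
  fixes C :: "('o, 'a, 'm) precategory_scheme" (structure)
  assumes Dom_Obj: "f \<in> Arr C \<Longrightarrow> Dom C f \<in> Obj C"
    and Cod_Obj: "f \<in> Arr C \<Longrightarrow> Cod C f \<in> Obj C"
    and Id_hom: "A \<in> Obj C \<Longrightarrow> Id C A \<in> hom C A A"
    and Comp_hom: "f \<in> hom C A B \<Longrightarrow> g \<in> hom C B D \<Longrightarrow> g \<cdot> f \<in> hom C A D"
    and Comp_Id: "f \<in> hom C A B \<Longrightarrow> f \<cdot> Id C A = f"
    and Id_Comp: "f \<in> hom C A B \<Longrightarrow> Id C B \<cdot> f = f"
    and Comp_assoc: "f \<in> hom C A B \<Longrightarrow> g \<in> hom C B D \<Longrightarrow> h \<in> hom C D E \<Longrightarrow>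
      (h \<cdot> g) \<cdot> f = h \<cdot> (g \<cdot> f)"

definition is_functor ::
    "('i, 'u) precategory \<Rightarrow> ('o, 'a) precategory \<Rightarrow> ('i \<Rightarrow> 'o) \<Rightarrow> ('u \<Rightarrow> 'a) \<Rightarrow> bool" where
  "is_functor J C Fo Fa \<longleftrightarrow>
     category J \<and> category C \<and>
     (\<forall>i \<in> Obj J. Fo i \<in> Obj C) \<and>
     (\<forall>u \<in> Arr J. Fa u \<in> hom C (Fo (Dom J u)) (Fo (Cod J u))) \<and>
     (\<forall>i \<in> Obj J. Fa (Id J i) = Id C (Fo i)) \<and>
     (\<forall>u \<in> Arr J. \<forall>v \<in> Arr J. Cod J u = Dom J v \<longrightarrow> Fa (v \<cdot>\<^bsub>J\<^esub> u) = Fa v \<cdot>\<^bsub>C\<^esub> Fa u)"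

definition is_cone ::
    "('i, 'u) precategory \<Rightarrow> ('o, 'a) precategory \<Rightarrow> ('i \<Rightarrow> 'o) \<Rightarrow> ('u \<Rightarrow> 'a)
      \<Rightarrow> 'o \<Rightarrow> ('i \<Rightarrow> 'a) \<Rightarrow> bool" where
  "is_cone J C Fo Fa L l \<longleftrightarrow>
     L \<in> Obj C \<and>
     (\<forall>i \<in> Obj J. l i \<in> hom C L (Fo i)) \<and>
     (\<forall>u \<in> Arr J. Fa u \<cdot>\<^bsub>C\<^esub> l (Dom J u) = l (Cod J u))"

definition is_limit ::
    "('i, 'u) precategory \<Rightarrow> ('o, 'a) precategory \<Rightarrow> ('i \<Rightarrow> 'o) \<Rightarrow> ('u \<Rightarrow> 'a)
      \<Rightarrow> 'o \<Rightarrow> ('i \<Rightarrow> 'a) \<Rightarrow> bool" where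
  "is_limit J C Fo Fa L l \<longleftrightarrow>
     is_cone J C Fo Fa L l \<and>
     (\<forall>M m. is_cone J C Fo Fa M m \<longrightarrow>
        (\<exists>!h. h \<in> hom C M L \<and> (\<forall>i \<in> Obj J. l i \<cdot>\<^bsub>C\<^esub> h = m i)))"

text \<open>
  Every finite category is isomorphic to one whose objects and arrows are natural numbers,
  so it suffices to let the shape \<open>J\<close> range over these.
\<close>

definition finitely_complete :: "('o, 'a) precategory \<Rightarrow> bool" where
  "finitely_complete C \<longleftrightarrow>
     category C \<and>
     (\<forall>(J :: (nat, nat) precategory) Fo Fa.
        finite (Obj J) \<and> finite (Arr J) \<and> is_functor J C Fo Fa \<longrightarrow>
        (\<exists>L l. is_limit J C Fo Fa L l))"

definition is_product ::
    "('o, 'a) precategory \<Rightarrow> 'i set \<Rightarrow> ('i \<Rightarrow> 'o) \<Rightarrow> 'o \<Rightarrow> ('i \<Rightarrow> 'a) \<Rightarrow> bool" where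
  "is_product C I X P p \<longleftrightarrow>
     P \<in> Obj C \<and> (\<forall>i \<in> I. p i \<in> hom C P (X i)) \<and>
     (\<forall>S \<in> Obj C. \<forall>x. (\<forall>i \<in> I. x i \<in> hom C S (X i)) \<longrightarrow>
        (\<exists>!h. h \<in> hom C S P \<and> (\<forall>i \<in> I. p i \<cdot>\<^bsub>C\<^esub> h = x i)))"

definition has_finite_products :: "('o, 'a) precategory \<Rightarrow> bool" where
  "has_finite_products C \<longleftrightarrow>
     (\<forall>(n :: nat) X. (\<forall>i < n. X i \<in> Obj C) \<longrightarrow> (\<exists>P p. is_product C {..<n} X P p))"

definition is_binary_product ::
    "('o, 'a) precategory \<Rightarrow> 'o \<Rightarrow> 'o \<Rightarrow> 'o \<Rightarrow> 'a \<Rightarrow> 'a \<Rightarrow> bool" where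
  "is_binary_product C X Y P p q \<longleftrightarrow>
     p \<in> hom C P X \<and> q \<in> hom C P Y \<and>
     (\<forall>S \<in> Obj C. \<forall>x \<in> hom C S X. \<forall>y \<in> hom C S Y.
        \<exists>!h. h \<in> hom C S P \<and> p \<cdot>\<^bsub>C\<^esub> h = x \<and> q \<cdot>\<^bsub>C\<^esub> h = y)"

text \<open>The morphism \<open>(x, y)\<close> into the product with projections \<open>p\<close> and \<open>q\<close>.\<close>

definition pairing :: "('o, 'a) precategory \<Rightarrow> 'a \<Rightarrow> 'a \<Rightarrow> 'a \<Rightarrow> 'a \<Rightarrow> 'a" where
  "pairing C p q x y =
     (THE h. h \<in> hom C (Dom C x) (Dom C p) \<and> p \<cdot>\<^bsub>C\<^esub> h = x \<and> q \<cdot>\<^bsub>C\<^esub> h = y)"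

definition is_pullback ::
    "('o, 'a) precategory \<Rightarrow> 'a \<Rightarrow> 'a \<Rightarrow> 'o \<Rightarrow> 'a \<Rightarrow> 'a \<Rightarrow> bool" where
  "is_pullback C f g P p q \<longleftrightarrow>
     p \<in> hom C P (Dom C f) \<and> q \<in> hom C P (Dom C g) \<and> f \<cdot>\<^bsub>C\<^esub> p = g \<cdot>\<^bsub>C\<^esub> q \<and>
     (\<forall>S \<in> Obj C. \<forall>x \<in> hom C S (Dom C f). \<forall>y \<in> hom C S (Dom C g).
        f \<cdot>\<^bsub>C\<^esub> x = g \<cdot>\<^bsub>C\<^esub> y \<longrightarrow>
        (\<exists>!h. h \<in> hom C S P \<and> p \<cdot>\<^bsub>C\<^esub> h = x \<and> q \<cdot>\<^bsub>C\<^esub> h = y))"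


section \<open>Internal equivalence relations\<close>

text \<open>
  An internal relation on \<open>X\<close>, that is, a subobject of \<open>X \<times> X\<close>, is represented by the jointly
  monic pair \<open>R = (r\<^sub>1, r\<^sub>2)\<close> of its two projections to \<open>X\<close>.
\<close>

definition is_relation :: "('o, 'a) precategory \<Rightarrow> 'o \<Rightarrow> 'a \<times> 'a \<Rightarrow> bool" where
  "is_relation C X R \<longleftrightarrow>
     fst R \<in> hom C (Dom C (fst R)) X \<and> snd R \<in> hom C (Dom C (fst R)) X \<and>
     (\<forall>S \<in> Obj C. \<forall>u \<in> hom C S (Dom C (fst R)). \<forall>v \<in> hom C S (Dom C (fst R)).
        fst R \<cdot>\<^bsub>C\<^esub> u = fst R \<cdot>\<^bsub>C\<^esub> v \<and> snd R \<cdot>\<^bsub>C\<^esub> u = snd R \<cdot>\<^bsub>C\<^esub> v \<longrightarrow> u = v)"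

text \<open>
  \<open>(x, y) \<in> R\<close> for generalised elements \<open>x\<close>, \<open>y\<close> with a common domain: the pair factors
  through \<open>R\<close>.
\<close>

definition in_rel :: "('o, 'a) precategory \<Rightarrow> 'a \<Rightarrow> 'a \<Rightarrow> 'a \<times> 'a \<Rightarrow> bool" where
  "in_rel C x y R \<longleftrightarrow>
     (\<exists>u \<in> hom C (Dom C x) (Dom C (fst R)). fst R \<cdot>\<^bsub>C\<^esub> u = x \<and> snd R \<cdot>\<^bsub>C\<^esub> u = y)"

text \<open>The order of subobjects of \<open>X \<times> X\<close>.\<close>

definition rel_le :: "('o, 'a) precategory \<Rightarrow> 'a \<times> 'a \<Rightarrow> 'a \<times> 'a \<Rightarrow> bool" where
  "rel_le C R T \<longleftrightarrow>
     (\<exists>h \<in> hom C (Dom C (fst R)) (Dom C (fst T)).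
        fst T \<cdot>\<^bsub>C\<^esub> h = fst R \<and> snd T \<cdot>\<^bsub>C\<^esub> h = snd R)"

text \<open>
  \<open>I = R \<inter> S\<close>: the pullback of the monomorphisms \<open>R \<rightarrow> X \<times> X\<close> and \<open>S \<rightarrow> X \<times> X\<close>, unfolded
  into components. It is determined up to isomorphism.
\<close>

definition is_intersection ::
    "('o, 'a) precategory \<Rightarrow> 'o \<Rightarrow> 'a \<times> 'a \<Rightarrow> 'a \<times> 'a \<Rightarrow> 'a \<times> 'a \<Rightarrow> bool" where
  "is_intersection C X R S I \<longleftrightarrow>
     is_relation C X I \<and>
     (\<exists>p \<in> hom C (Dom C (fst I)) (Dom C (fst R)).
      \<exists>q \<in> hom C (Dom C (fst I)) (Dom C (fst S)).
        fst R \<cdot>\<^bsub>C\<^esub> p = fst I \<and> snd R \<cdot>\<^bsub>C\<^esub> p = snd I \<and>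
        fst S \<cdot>\<^bsub>C\<^esub> q = fst I \<and> snd S \<cdot>\<^bsub>C\<^esub> q = snd I \<and>
        (\<forall>A \<in> Obj C. \<forall>u \<in> hom C A (Dom C (fst R)). \<forall>v \<in> hom C A (Dom C (fst S)).
           fst R \<cdot>\<^bsub>C\<^esub> u = fst S \<cdot>\<^bsub>C\<^esub> v \<and> snd R \<cdot>\<^bsub>C\<^esub> u = snd S \<cdot>\<^bsub>C\<^esub> v \<longrightarrow>
           (\<exists>!h. h \<in> hom C A (Dom C (fst I)) \<and> p \<cdot>\<^bsub>C\<^esub> h = u \<and> q \<cdot>\<^bsub>C\<^esub> h = v)))"

text \<open>
  Reflexivity, symmetry and transitivity are witnessed by morphisms \<open>X \<rightarrow> R\<close>, \<open>R \<rightarrow> R\<close> and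
  \<open>R \<times>\<^sub>X R \<rightarrow> R\<close>. The pullback \<open>R \<times>\<^sub>X R\<close> of \<open>r\<^sub>2\<close> and \<open>r\<^sub>1\<close> is only determined up to
  isomorphism; it exists in all categories to which the notion is applied below.
\<close>

definition is_equivalence_relation ::
    "('o, 'a) precategory \<Rightarrow> 'o \<Rightarrow> 'a \<times> 'a \<Rightarrow> bool" where
  "is_equivalence_relation C X R \<longleftrightarrow>
     is_relation C X R \<and>
     (\<exists>e \<in> hom C X (Dom C (fst R)).
        fst R \<cdot>\<^bsub>C\<^esub> e = Id C X \<and> snd R \<cdot>\<^bsub>C\<^esub> e = Id C X) \<and>
     (\<exists>s \<in> hom C (Dom C (fst R)) (Dom C (fst R)).
        fst R \<cdot>\<^bsub>C\<^esub> s = snd R \<and> snd R \<cdot>\<^bsub>C\<^esub> s = fst R) \<and>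
     (\<forall>P p q. is_pullback C (snd R) (fst R) P p q \<longrightarrow>
        (\<exists>t \<in> hom C P (Dom C (fst R)).
           fst R \<cdot>\<^bsub>C\<^esub> t = fst R \<cdot>\<^bsub>C\<^esub> p \<and> snd R \<cdot>\<^bsub>C\<^esub> t = snd R \<cdot>\<^bsub>C\<^esub> q))"


section \<open>Gumm categories\<close>

definition gumm_category :: "('o, 'a) precategory \<Rightarrow> bool" where
  "gumm_category C \<longleftrightarrow>
     finitely_complete C \<and>
     (\<forall>X \<in> Obj C. \<forall>R S T I.
        is_equivalence_relation C X R \<and> is_equivalence_relation C X S \<and>
        is_equivalence_relation C X T \<and>
        is_intersection C X R S I \<and> rel_le C I T \<longrightarrow>
        (\<forall>A \<in> Obj C. \<forall>x \<in> hom C A X. \<forall>y \<in> hom C A X. \<forall>z \<in> hom C A X. \<forall>w \<in> hom C A X.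
           in_rel C x y R \<and> in_rel C w z R \<and>
           in_rel C y z S \<and> in_rel C x w S \<and>
           in_rel C y z T \<longrightarrow>
           in_rel C x w T))"


section \<open>Pointed and centralic categories\<close>

definition is_zero_object :: "('o, 'a) precategory \<Rightarrow> 'o \<Rightarrow> bool" where
  "is_zero_object C Z \<longleftrightarrow>
     Z \<in> Obj C \<and>
     (\<forall>A \<in> Obj C. (\<exists>!f. f \<in> hom C A Z) \<and> (\<exists>!f. f \<in> hom C Z A))"

definition pointed_category :: "('o, 'a) precategory \<Rightarrow> bool" where
  "pointed_category C \<longleftrightarrow> category C \<and> (\<exists>Z. is_zero_object C Z)"

text \<open>The zero morphism \<open>A \<rightarrow> B\<close>: the composite through any zero object.\<close>

definition zero_mor :: "('o, 'a) precategory \<Rightarrow> 'o \<Rightarrow> 'o \<Rightarrow> 'a" where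
  "zero_mor C A B =
     (THE f. \<exists>Z g h. is_zero_object C Z \<and> g \<in> hom C A Z \<and> h \<in> hom C Z B \<and> f = h \<cdot>\<^bsub>C\<^esub> g)"

definition centralic_category :: "('o, 'a) precategory \<Rightarrow> bool" where
  "centralic_category C \<longleftrightarrow>
     pointed_category C \<and> has_finite_products C \<and>
     (\<forall>X Y P p q Z f. is_binary_product C X Y P p q \<and> f \<in> hom C P Z \<longrightarrow>
        (\<forall>S \<in> Obj C. \<forall>x \<in> hom C S X. \<forall>x' \<in> hom C S X. \<forall>y \<in> hom C S Y.
           f \<cdot>\<^bsub>C\<^esub> pairing C p q x (zero_mor C S Y) = f \<cdot>\<^bsub>C\<^esub> pairing C p q x' (zero_mor C S Y) \<longrightarrow>
           f \<cdot>\<^bsub>C\<^esub> pairing C p q x y = f \<cdot>\<^bsub>C\<^esub> pairing C p q x' y))"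

end

theory Submission
  imports Defs
begin

text \<open>
  Let \<open>f\<close> be a morphism on \<open>P = X \<times> Y\<close>, with projections \<open>p\<close> and \<open>q\<close>, and let
  \<open>f(x, 0) = f(x', 0)\<close>. The four generalised elements \<open>(x, y)\<close>, \<open>(x, 0)\<close>, \<open>(x', 0)\<close> and
  \<open>(x', y)\<close> of \<open>P\<close> are the corners of a rectangle: two of its sides lie in the kernel pair of
  \<open>p\<close> and the other two in the kernel pair of \<open>q\<close>. These kernel pairs meet in the diagonal,
  because \<open>p\<close> and \<open>q\<close> are jointly monic, so their intersection lies below the kernel pair of
  \<open>f\<close>. The Gumm property, applied to the three kernel pairs, shifts the equality
  \<open>f(x, 0) = f(x', 0)\<close> along the rectangle to \<open>f(x, y) = f(x', y)\<close>.

  The three kernel pairs are pullbacks, hence available in a finitely complete category, and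
  membership in the kernel pair of \<open>g\<close> just means equality after composition with \<open>g\<close>
  (\<open>in_rel_kernel_pair_iff\<close>), so that each corner condition is an equation between composites
  of projections with pairings.
\<close>

section \<open>Products and pullbacks from finite limits\<close>

lemma category_if_finitely_complete: "finitely_complete C \<Longrightarrow> category C"
  by (simp add: finitely_complete_def)

lemma limit_if_finitely_complete:
  fixes J :: "(nat, nat) precategory"
  assumes "finitely_complete C" "is_functor J C Fo Fa" "finite (Obj J)" "finite (Arr J)"
  shows "\<exists>L l. is_limit J C Fo Fa L l"
  using assms unfolding finitely_complete_def by blast

lemma hom_Obj:
  assumes "category C" "f \<in> hom C A B"
  shows "A \<in> Obj C" "B \<in> Obj C"
  using assms category.Dom_Obj category.Cod_Obj unfolding hom_def by fastforce+

lemma hom_Dom: "f \<in> hom C A B \<Longrightarrow> Dom C f = A"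
  by (simp add: hom_def)

definition discrete :: "nat \<Rightarrow> (nat, nat) precategory" where
  "discrete n = \<lparr>Obj = {..<n}, Arr = {..<n}, Dom = (\<lambda>i. i), Cod = (\<lambda>i. i), Id = (\<lambda>i. i),
     Comp = (\<lambda>g f. f)\<rparr>"

lemma category_discrete: "category (discrete n)"
  by unfold_locales (auto simp: discrete_def hom_def)

lemma finite_products_if_finitely_complete:
  assumes "finitely_complete C"
  shows "has_finite_products C"
  unfolding has_finite_products_def
proof (intro allI impI)
  fix n :: nat and X
  assume X: "\<forall>i<n. X i \<in> Obj C"
  interpret category C using assms by (rule category_if_finitely_complete)
  let ?Fa = "\<lambda>i. Id C (X i)"
  have "is_functor (discrete n) C X ?Fa"
    unfolding is_functor_def
    using X category_discrete category_axioms Id_hom Comp_Id[OF Id_hom]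
    by (auto simp: discrete_def)
  then obtain L l where L: "is_limit (discrete n) C X ?Fa L l"
    using limit_if_finitely_complete[OF assms] by (force simp: discrete_def)
  \<comment> \<open>The only arrows of the shape are identities, so a cone is nothing but a family of morphisms.\<close>
  have cone: "is_cone (discrete n) C X ?Fa M m \<longleftrightarrow> M \<in> Obj C \<and> (\<forall>i<n. m i \<in> hom C M (X i))"
    for M m
    unfolding is_cone_def using Id_Comp by (auto simp: discrete_def)
  have "is_product C {..<n} X L l"
    using L unfolding is_limit_def cone is_product_def by (auto simp: discrete_def)
  then show "\<exists>P p. is_product C {..<n} X P p" by blast
qed

text \<open>
  The arrows \<open>0\<close>, \<open>1\<close>, \<open>2\<close> are the identities of the objects of the same name, and \<open>3\<close>, \<open>4\<close>
  are the legs \<open>0 \<rightarrow> 2 \<leftarrow> 1\<close>. In a composable pair at least one arrow is an identity,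
  so the composite is the other one.
\<close>

definition cospan :: "(nat, nat) precategory" where
  "cospan = \<lparr>Obj = {0, 1, 2}, Arr = {0, 1, 2, 3, 4},
     Dom = (\<lambda>u. if u < 3 then u else u - 3), Cod = (\<lambda>u. if u < 3 then u else 2),
     Id = (\<lambda>i. i), Comp = (\<lambda>g f. if f < 3 then g else f)\<rparr>"

lemma category_cospan: "category cospan"
  by unfold_locales (auto simp: cospan_def hom_def)

lemma pullback_if_finitely_complete:
  fixes C (structure)
  assumes fc: "finitely_complete C" and f: "f \<in> hom C A D" and g: "g \<in> hom C B D"
  shows "\<exists>P p q. is_pullback C f g P p q"
proof -
  interpret category C using fc by (rule category_if_finitely_complete)
  note obj = hom_Obj[OF category_axioms]
  note dom = hom_Dom[OF f] hom_Dom[OF g]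
  define Fo where "Fo = (\<lambda>i::nat. if i = 0 then A else if i = 1 then B else D)"
  define Fa where "Fa = (\<lambda>u::nat. if u = 3 then f else if u = 4 then g else Id C (Fo u))"
  have "is_functor cospan C Fo Fa"
    unfolding is_functor_def
    using f g obj[OF f] obj[OF g] category_cospan category_axioms Id_hom Comp_Id[OF Id_hom] Comp_Id Id_Comp
    by (auto simp: cospan_def Fo_def Fa_def)
  then obtain L l where L: "is_limit cospan C Fo Fa L l"
    using limit_if_finitely_complete[OF fc] by (force simp: cospan_def)
  have cone: "is_cone cospan C Fo Fa M m \<longleftrightarrow> M \<in> Obj C \<and> m 0 \<in> hom C M A \<and> m 1 \<in> hom C M B \<and>
      m 2 \<in> hom C M D \<and> f \<cdot> m 0 = m 2 \<and> g \<cdot> m 1 = m 2" for M m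
    unfolding is_cone_def using Id_Comp by (auto simp: cospan_def Fo_def Fa_def)
  have "is_pullback C f g L (l 0) (l 1)"
    unfolding is_pullback_def dom
  proof (intro conjI ballI impI)
    show "l 0 \<in> hom C L A" "l 1 \<in> hom C L B" "f \<cdot> l 0 = g \<cdot> l 1"
      using L unfolding is_limit_def cone by auto
    fix S x y
    assume S: "S \<in> Obj C" and x: "x \<in> hom C S A" and y: "y \<in> hom C S B" and eq: "f \<cdot> x = g \<cdot> y"
    let ?m = "\<lambda>i::nat. if i = 0 then x else if i = 1 then y else f \<cdot> x"
    have "is_cone cospan C Fo Fa S ?m"
      unfolding cone using S x y eq Comp_hom[OF x f] by simp
    then have "\<exists>!h. h \<in> hom C S L \<and> (\<forall>i \<in> Obj cospan. l i \<cdot> h = ?m i)"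
      using L unfolding is_limit_def by blast
    moreover have "(\<forall>i \<in> Obj cospan. l i \<cdot> h = ?m i) \<longleftrightarrow> l 0 \<cdot> h = x \<and> l 1 \<cdot> h = y"
      if h: "h \<in> hom C S L" for h
    proof -
      have l: "l 0 \<in> hom C L A" "l 2 = f \<cdot> l 0" using L unfolding is_limit_def cone by auto
      have "l 2 \<cdot> h = f \<cdot> (l 0 \<cdot> h)" using Comp_assoc[OF h l(1) f] l(2) by simp
      then show ?thesis by (auto simp: cospan_def)
    qed
    ultimately show "\<exists>!h. h \<in> hom C S L \<and> l 0 \<cdot> h = x \<and> l 1 \<cdot> h = y"
      by (metis (no_types, lifting))
  qed
  then show ?thesis by blast
qed


section \<open>Kernel pairs\<close>

lemma in_rel_kernel_pair_iff:
  fixes C (structure)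
  assumes C: "category C" and f: "f \<in> hom C A B" and K: "is_pullback C f f K k\<^sub>1 k\<^sub>2"
    and x: "x \<in> hom C S A" and y: "y \<in> hom C S A"
  shows "in_rel C x y (k\<^sub>1, k\<^sub>2) \<longleftrightarrow> f \<cdot> x = f \<cdot> y"
proof -
  interpret category C by fact
  have k: "k\<^sub>1 \<in> hom C K A" "k\<^sub>2 \<in> hom C K A" and eq: "f \<cdot> k\<^sub>1 = f \<cdot> k\<^sub>2"
    using K hom_Dom[OF f] by (auto simp: is_pullback_def)
  have "f \<cdot> x = f \<cdot> y" if xy: "in_rel C x y (k\<^sub>1, k\<^sub>2)"
  proof -
    obtain u where u: "u \<in> hom C S K" "k\<^sub>1 \<cdot> u = x" "k\<^sub>2 \<cdot> u = y"
      using xy hom_Dom[OF x] hom_Dom[OF k(1)] by (auto simp: in_rel_def)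
    then show ?thesis
      using Comp_assoc[OF u(1) k(1) f] Comp_assoc[OF u(1) k(2) f] eq by simp
  qed
  moreover have "in_rel C x y (k\<^sub>1, k\<^sub>2)" if "f \<cdot> x = f \<cdot> y"
  proof -
    have "\<exists>!h. h \<in> hom C S K \<and> k\<^sub>1 \<cdot> h = x \<and> k\<^sub>2 \<cdot> h = y"
      using K x y that hom_Obj[OF category_axioms x] hom_Dom[OF f] unfolding is_pullback_def by simp
    then show ?thesis using hom_Dom[OF x] hom_Dom[OF k(1)] by (auto simp: in_rel_def)
  qed
  ultimately show ?thesis by blast
qed

text \<open>
  Reflexivity, symmetry and transitivity all come down to the same properties of equality after
  composition with \<open>f\<close>: each witness is the factorisation of the pair that it has to represent.
\<close>

lemma is_equivalence_relation_kernel_pair: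
  fixes C (structure)
  assumes C: "category C" and f: "f \<in> hom C A B" and K: "is_pullback C f f K k\<^sub>1 k\<^sub>2"
  shows "is_equivalence_relation C A (k\<^sub>1, k\<^sub>2)"
proof -
  interpret category C by fact
  have k: "k\<^sub>1 \<in> hom C K A" "k\<^sub>2 \<in> hom C K A" and eq: "f \<cdot> k\<^sub>1 = f \<cdot> k\<^sub>2"
    using K hom_Dom[OF f] by (auto simp: is_pullback_def)
  have dom [simp]: "Dom C k\<^sub>1 = K" "Dom C k\<^sub>2 = K" using k by (auto simp: hom_def)
  note obj = hom_Obj[OF category_axioms]
  have factor: "\<exists>h \<in> hom C S K. k\<^sub>1 \<cdot> h = x \<and> k\<^sub>2 \<cdot> h = y"
    if "x \<in> hom C S A" "y \<in> hom C S A" "f \<cdot> x = f \<cdot> y" for S x y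
    using in_rel_kernel_pair_iff[OF C f K that(1,2)] that(3) hom_Dom[OF that(1)]
    by (simp add: in_rel_def)
  have "u = v" if S: "S \<in> Obj C" and u: "u \<in> hom C S K" and v: "v \<in> hom C S K"
    and uv: "k\<^sub>1 \<cdot> u = k\<^sub>1 \<cdot> v" "k\<^sub>2 \<cdot> u = k\<^sub>2 \<cdot> v" for S u v
  proof -
    have "f \<cdot> (k\<^sub>1 \<cdot> u) = f \<cdot> (k\<^sub>2 \<cdot> u)"
      using Comp_assoc[OF u k(1) f] Comp_assoc[OF u k(2) f] eq by simp
    then have "\<exists>!h. h \<in> hom C S K \<and> k\<^sub>1 \<cdot> h = k\<^sub>1 \<cdot> u \<and> k\<^sub>2 \<cdot> h = k\<^sub>2 \<cdot> u"
      using K S Comp_hom[OF u k(1)] Comp_hom[OF u k(2)] hom_Dom[OF f]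
      unfolding is_pullback_def by blast
    then show ?thesis using u v uv by metis
  qed
  then have "is_relation C A (k\<^sub>1, k\<^sub>2)" using k by (simp add: is_relation_def)
  moreover have "\<exists>e \<in> hom C A K. k\<^sub>1 \<cdot> e = Id C A \<and> k\<^sub>2 \<cdot> e = Id C A"
    using factor Id_hom[OF obj(1)[OF f]] by blast
  moreover have "\<exists>s \<in> hom C K K. k\<^sub>1 \<cdot> s = k\<^sub>2 \<and> k\<^sub>2 \<cdot> s = k\<^sub>1"
    using factor k eq by simp
  moreover have "\<exists>t \<in> hom C Q K. k\<^sub>1 \<cdot> t = k\<^sub>1 \<cdot> a \<and> k\<^sub>2 \<cdot> t = k\<^sub>2 \<cdot> b"
    if "is_pullback C k\<^sub>2 k\<^sub>1 Q a b" for Q a b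
  proof -
    have a: "a \<in> hom C Q K" and b: "b \<in> hom C Q K" and ab: "k\<^sub>2 \<cdot> a = k\<^sub>1 \<cdot> b"
      using that by (auto simp: is_pullback_def)
    have "f \<cdot> (k\<^sub>1 \<cdot> a) = f \<cdot> (k\<^sub>2 \<cdot> a)"
      using Comp_assoc[OF a k(1) f] Comp_assoc[OF a k(2) f] eq by simp
    also have "\<dots> = f \<cdot> (k\<^sub>2 \<cdot> b)"
      using Comp_assoc[OF b k(1) f] Comp_assoc[OF b k(2) f] eq ab by simp
    finally show ?thesis using factor Comp_hom[OF a k(1)] Comp_hom[OF b k(2)] by blast
  qed
  ultimately show ?thesis by (simp add: is_equivalence_relation_def)
qed

text \<open>
  If \<open>p\<close> and \<open>q\<close> are jointly monic, a pair of elements identified by both is an equal pair, so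
  the diagonal, mapped by reflexivity into either kernel pair, is their intersection.
\<close>

lemma is_intersection_kernel_pairs:
  fixes C (structure)
  assumes C: "category C" and p: "p \<in> hom C A X" and q: "q \<in> hom C A Y"
    and K: "is_pullback C p p K k\<^sub>1 k\<^sub>2" and L: "is_pullback C q q L l\<^sub>1 l\<^sub>2"
    and monic: "\<And>S a b. a \<in> hom C S A \<Longrightarrow> b \<in> hom C S A \<Longrightarrow> p \<cdot> a = p \<cdot> b \<Longrightarrow>
      q \<cdot> a = q \<cdot> b \<Longrightarrow> a = b"
  shows "is_intersection C A (k\<^sub>1, k\<^sub>2) (l\<^sub>1, l\<^sub>2) (Id C A, Id C A)"
proof -
  interpret category C by fact
  have k: "k\<^sub>1 \<in> hom C K A" "k\<^sub>2 \<in> hom C K A" and l: "l\<^sub>1 \<in> hom C L A" "l\<^sub>2 \<in> hom C L A"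
    using K L hom_Dom[OF p] hom_Dom[OF q] by (auto simp: is_pullback_def)
  have id: "Id C A \<in> hom C A A" by (rule Id_hom[OF hom_Obj(1)[OF C p]])
  have dom [simp]: "Dom C (Id C A) = A" "Dom C k\<^sub>1 = K" "Dom C l\<^sub>1 = L"
    using id k l by (auto simp: hom_def)
  have K_rel: "is_relation C A (k\<^sub>1, k\<^sub>2)" and L_rel: "is_relation C A (l\<^sub>1, l\<^sub>2)"
    using is_equivalence_relation_kernel_pair[OF C p K]
      is_equivalence_relation_kernel_pair[OF C q L]
    by (auto simp: is_equivalence_relation_def)
  obtain d where d: "d \<in> hom C A K" "k\<^sub>1 \<cdot> d = Id C A" "k\<^sub>2 \<cdot> d = Id C A"
    using is_equivalence_relation_kernel_pair[OF C p K] by (auto simp: is_equivalence_relation_def)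
  obtain e where e: "e \<in> hom C A L" "l\<^sub>1 \<cdot> e = Id C A" "l\<^sub>2 \<cdot> e = Id C A"
    using is_equivalence_relation_kernel_pair[OF C q L] by (auto simp: is_equivalence_relation_def)
  have "\<exists>!h. h \<in> hom C S A \<and> d \<cdot> h = u \<and> e \<cdot> h = v"
    if S: "S \<in> Obj C" and u: "u \<in> hom C S K" and v: "v \<in> hom C S L"
      and uv: "k\<^sub>1 \<cdot> u = l\<^sub>1 \<cdot> v" "k\<^sub>2 \<cdot> u = l\<^sub>2 \<cdot> v" for S u v
  proof -
    let ?a = "k\<^sub>1 \<cdot> u" and ?b = "k\<^sub>2 \<cdot> u"
    have a: "?a \<in> hom C S A" and b: "?b \<in> hom C S A" using Comp_hom[OF u] k by auto
    have "in_rel C ?a ?b (k\<^sub>1, k\<^sub>2)" "in_rel C ?a ?b (l\<^sub>1, l\<^sub>2)"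
      using u v uv hom_Dom[OF a] by (auto simp: in_rel_def)
    then have "p \<cdot> ?a = p \<cdot> ?b" "q \<cdot> ?a = q \<cdot> ?b"
      using in_rel_kernel_pair_iff[OF C p K a b] in_rel_kernel_pair_iff[OF C q L a b] by auto
    then have ab: "?a = ?b" using monic[OF a b] by simp
    have comp: "k\<^sub>1 \<cdot> (d \<cdot> h) = h" "k\<^sub>2 \<cdot> (d \<cdot> h) = h" "l\<^sub>1 \<cdot> (e \<cdot> h) = h" "l\<^sub>2 \<cdot> (e \<cdot> h) = h"
      if h: "h \<in> hom C S A" for h
      using Comp_assoc[OF h d(1) k(1)] Comp_assoc[OF h d(1) k(2)] Comp_assoc[OF h e(1) l(1)]
        Comp_assoc[OF h e(1) l(2)] Id_Comp[OF h] d e by auto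
    have "d \<cdot> ?a = u"
      using K_rel S u Comp_hom[OF a d(1)] comp[OF a] ab unfolding is_relation_def by simp
    moreover have "e \<cdot> ?a = v"
      using L_rel S v Comp_hom[OF a e(1)] comp[OF a] ab uv unfolding is_relation_def by simp
    ultimately show ?thesis using a comp(1) by metis
  qed
  moreover have "is_relation C A (Id C A, Id C A)"
    using id Id_Comp by (simp add: is_relation_def)
  ultimately show ?thesis
    unfolding is_intersection_def fst_conv snd_conv dom
    by (intro conjI bexI[OF _ d(1)] bexI[OF _ e(1)] ballI impI) (auto simp: d e)
qed

lemma rel_le_diagonal_kernel_pair:
  assumes "category C" "f \<in> hom C A B" "is_pullback C f f K k\<^sub>1 k\<^sub>2"
  shows "rel_le C (Id C A, Id C A) (k\<^sub>1, k\<^sub>2)"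
  using is_equivalence_relation_kernel_pair[OF assms]
    category.Id_hom[OF assms(1) hom_Obj(1)[OF assms(1,2)]]
  by (simp add: is_equivalence_relation_def rel_le_def hom_def)


section \<open>Zero morphisms and pairings\<close>

lemma zero_object_hom_ex:
  assumes "is_zero_object C Z" "A \<in> Obj C"
  shows "\<exists>f. f \<in> hom C A Z" "\<exists>f. f \<in> hom C Z A"
  using assms unfolding is_zero_object_def by metis+

lemma to_zero_unique:
  assumes "is_zero_object C Z" "A \<in> Obj C" "f \<in> hom C A Z" "g \<in> hom C A Z"
  shows "f = g"
  using assms unfolding is_zero_object_def by metis

lemma from_zero_unique:
  assumes "is_zero_object C Z" "B \<in> Obj C" "f \<in> hom C Z B" "g \<in> hom C Z B"
  shows "f = g"
  using assms unfolding is_zero_object_def by metis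

text \<open>
  The definite description in \<open>zero_mor\<close> denotes because the composites through two zero objects
  \<open>Z\<close> and \<open>Z'\<close> agree: the unique morphism \<open>Z \<rightarrow> Z'\<close> compares them.
\<close>

lemma zero_mor_hom:
  fixes C (structure)
  assumes pointed: "pointed_category C" and A: "A \<in> Obj C" and B: "B \<in> Obj C"
  shows "zero_mor C A B \<in> hom C A B"
proof -
  interpret category C using pointed by (simp add: pointed_category_def)
  let ?zero = "\<lambda>f. \<exists>Z g h. is_zero_object C Z \<and> g \<in> hom C A Z \<and> h \<in> hom C Z B \<and> f = h \<cdot> g"
  have unique: "h \<cdot> g = h' \<cdot> g'"
    if Z: "is_zero_object C Z" and gh: "g \<in> hom C A Z" "h \<in> hom C Z B"
      and Z': "is_zero_object C Z'" and gh': "g' \<in> hom C A Z'" "h' \<in> hom C Z' B"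
    for Z g h Z' g' h'
  proof -
    obtain z where z: "z \<in> hom C Z Z'"
      using zero_object_hom_ex(2)[OF Z] Z' unfolding is_zero_object_def by metis
    have "h' \<cdot> z = h"
      using from_zero_unique[OF Z B Comp_hom[OF z gh'(2)] gh(2)] .
    moreover have "z \<cdot> g = g'"
      using to_zero_unique[OF Z' A Comp_hom[OF gh(1) z] gh'(1)] .
    ultimately show ?thesis using Comp_assoc[OF gh(1) z gh'(2)] by simp
  qed
  obtain Z where Z: "is_zero_object C Z" using pointed by (auto simp: pointed_category_def)
  then obtain g h where gh: "g \<in> hom C A Z" "h \<in> hom C Z B"
    using zero_object_hom_ex(1)[OF Z A] zero_object_hom_ex(2)[OF Z B] by auto
  have "?zero (zero_mor C A B)"
    unfolding zero_mor_def
  proof (rule theI[of ?zero "h \<cdot> g"])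
    show "?zero (h \<cdot> g)" using Z gh by blast
    show "f = h \<cdot> g" if "?zero f" for f using that unique[OF _ _ _ Z gh] by blast
  qed
  then show ?thesis using Comp_hom by metis
qed

lemma pairing:
  fixes C (structure)
  assumes C: "category C" and P: "is_binary_product C X Y P p q"
    and x: "x \<in> hom C S X" and y: "y \<in> hom C S Y"
  shows "pairing C p q x y \<in> hom C S P"
    and "p \<cdot> pairing C p q x y = x" and "q \<cdot> pairing C p q x y = y"
proof -
  have "Dom C p = P" using P by (simp add: is_binary_product_def hom_def)
  moreover have "\<exists>!h. h \<in> hom C S P \<and> p \<cdot> h = x \<and> q \<cdot> h = y"
    using P x y hom_Obj[OF C x] unfolding is_binary_product_def by blast
  ultimately have "pairing C p q x y \<in> hom C S P \<and> p \<cdot> pairing C p q x y = x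
      \<and> q \<cdot> pairing C p q x y = y"
    unfolding pairing_def hom_Dom[OF x] by (simp only:) (rule theI')
  then show "pairing C p q x y \<in> hom C S P"
    "p \<cdot> pairing C p q x y = x" "q \<cdot> pairing C p q x y = y" by auto
qed

lemma binary_product_jointly_monic:
  fixes C (structure)
  assumes C: "category C" and P: "is_binary_product C X Y P p q"
    and a: "a \<in> hom C S P" and b: "b \<in> hom C S P"
    and eq: "p \<cdot> a = p \<cdot> b" "q \<cdot> a = q \<cdot> b"
  shows "a = b"
proof -
  interpret category C by fact
  have pq: "p \<in> hom C P X" "q \<in> hom C P Y" using P by (auto simp: is_binary_product_def)
  have "\<exists>!h. h \<in> hom C S P \<and> p \<cdot> h = p \<cdot> b \<and> q \<cdot> h = q \<cdot> b"
    using P Comp_hom[OF b pq(1)] Comp_hom[OF b pq(2)] hom_Obj[OF C b]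
    unfolding is_binary_product_def by blast
  then show ?thesis using a b eq by metis
qed


section \<open>Pointed Gumm categories are centralic\<close>

text \<open>
  The rectangle argument, with an arbitrary \<open>y'\<close> in place of the zero morphism: two sides of
  the rectangle with corners \<open>(x, y)\<close>, \<open>(x, y')\<close>, \<open>(x', y')\<close>, \<open>(x', y)\<close> are identified by \<open>p\<close>
  and the other two by \<open>q\<close>.
\<close>

lemma gumm_category_shift:
  fixes C (structure)
  assumes gumm: "gumm_category C" and P: "is_binary_product C X Y P p q" and f: "f \<in> hom C P Z"
    and x: "x \<in> hom C S X" and x': "x' \<in> hom C S X" and y: "y \<in> hom C S Y" and y': "y' \<in> hom C S Y"
    and eq: "f \<cdot> pairing C p q x y' = f \<cdot> pairing C p q x' y'"
  shows "f \<cdot> pairing C p q x y = f \<cdot> pairing C p q x' y"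
proof -
  have fc: "finitely_complete C" using gumm by (simp add: gumm_category_def)
  then have C: "category C" by (rule category_if_finitely_complete)
  have p: "p \<in> hom C P X" and q: "q \<in> hom C P Y" using P by (auto simp: is_binary_product_def)
  obtain K\<^sub>p r\<^sub>1 r\<^sub>2 where R: "is_pullback C p p K\<^sub>p r\<^sub>1 r\<^sub>2"
    using pullback_if_finitely_complete[OF fc p p] by blast
  obtain K\<^sub>q s\<^sub>1 s\<^sub>2 where S: "is_pullback C q q K\<^sub>q s\<^sub>1 s\<^sub>2"
    using pullback_if_finitely_complete[OF fc q q] by blast
  obtain K\<^sub>f t\<^sub>1 t\<^sub>2 where T: "is_pullback C f f K\<^sub>f t\<^sub>1 t\<^sub>2"
    using pullback_if_finitely_complete[OF fc f f] by blast
  note eqv = is_equivalence_relation_kernel_pair[OF C]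
  have meet: "is_intersection C P (r\<^sub>1, r\<^sub>2) (s\<^sub>1, s\<^sub>2) (Id C P, Id C P)"
    using binary_product_jointly_monic[OF C P] by (rule is_intersection_kernel_pairs[OF C p q R S])
  note le = rel_le_diagonal_kernel_pair[OF C f T]
  note xy = pairing[OF C P x y] and xy' = pairing[OF C P x y']
    and x'y = pairing[OF C P x' y] and x'y' = pairing[OF C P x' y']
  have "in_rel C (pairing C p q x y) (pairing C p q x y') (r\<^sub>1, r\<^sub>2)"
    "in_rel C (pairing C p q x' y) (pairing C p q x' y') (r\<^sub>1, r\<^sub>2)"
    using in_rel_kernel_pair_iff[OF C p R] xy xy' x'y x'y' by auto
  moreover have "in_rel C (pairing C p q x y') (pairing C p q x' y') (s\<^sub>1, s\<^sub>2)"
    "in_rel C (pairing C p q x y) (pairing C p q x' y) (s\<^sub>1, s\<^sub>2)"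
    using in_rel_kernel_pair_iff[OF C q S] xy xy' x'y x'y' by auto
  moreover have "in_rel C (pairing C p q x y') (pairing C p q x' y') (t\<^sub>1, t\<^sub>2)"
    using in_rel_kernel_pair_iff[OF C f T xy'(1) x'y'(1)] eq by simp
  ultimately have "in_rel C (pairing C p q x y) (pairing C p q x' y) (t\<^sub>1, t\<^sub>2)"
    using gumm eqv[OF p R] eqv[OF q S] eqv[OF f T] meet le
      hom_Obj(1)[OF C p] hom_Obj(1)[OF C x] xy(1) xy'(1) x'y(1) x'y'(1)
    unfolding gumm_category_def by blast
  then show ?thesis using in_rel_kernel_pair_iff[OF C f T xy(1) x'y(1)] by simp
qed

theorem proposition2p9:
  fixes C :: "('o, 'a) precategory"
  assumes "pointed_category C" and "gumm_category C"
  shows "centralic_category C"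
proof -
  have fc: "finitely_complete C" using assms(2) by (simp add: gumm_category_def)
  have "f \<cdot>\<^bsub>C\<^esub> pairing C p q x y = f \<cdot>\<^bsub>C\<^esub> pairing C p q x' y"
    if P: "is_binary_product C X Y P p q" and f: "f \<in> hom C P Z" and S: "S \<in> Obj C"
      and x: "x \<in> hom C S X" and x': "x' \<in> hom C S X" and y: "y \<in> hom C S Y"
      and eq: "f \<cdot>\<^bsub>C\<^esub> pairing C p q x (zero_mor C S Y) = f \<cdot>\<^bsub>C\<^esub> pairing C p q x' (zero_mor C S Y)"
    for X Y P p q Z f S x x' y
  proof -
    have "Y \<in> Obj C" using hom_Obj(2)[OF category_if_finitely_complete[OF fc] y] .
    then have "zero_mor C S Y \<in> hom C S Y" using zero_mor_hom[OF assms(1) S] by simp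
    then show ?thesis using gumm_category_shift[OF assms(2) P f x x' y _ eq] by blast
  qed
  then show ?thesis
    unfolding centralic_category_def
    using assms(1) finite_products_if_finitely_complete[OF fc] by blast
qed

end
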